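(* Let $p\colon E\to B$ be a simplicial fibration where $B$ is a connected simplicial complex. Then any two simplicial fibers of $p$ have the same strong homotopy type.
   Context: Simplicial complexes are abstract simplicial complexes, not necessarily finite; simplicial maps are maps of vertex sets sending simplices to simplices. The (categorical) product $K\times L$ has vertex set $V(K)\times V(L)$, and a finite set of vertices is a simplex iff both its projections are simplices. For $m\ge1$, $I_m$ is the one-dimensional complex with vertices $0,\dots,m$ and edges $\{j,j+1\}$, $0\le j<m$. A simplicial map $p\colon E\to B$ is a simplicial fibration if for every simplicial complex $K$ (finite or not), every $m\ge1$, and all simplicial maps $H\colon K\times I_m\to B$ and $\varphi\colon K\times\{0\}\to E$ with $p(\varphi(v,0))=H(v,0)$ for all vertices $v$, there is a simplicial map $\widetilde H\colon K\times I_m\to E$ with $\widetilde H(v,0)=\varphi(v,0)$ for all $v$ and $p\circ\widetilde H=H$. $B$ is connected if for any two vertices $b,b'$ of $B$ there are $n\geq 1$ and a simplicial map $\gamma\colon I_n\to B$ with $\gamma(0)=b$, $\gamma(n)=b'$. The simplicial fiber of $p$ over a vertex $b_0$ of $B$ is the full subcomplex $F_{b_0}=p^{-1}(b_0)$ of $E$ generated by the vertices $e$ with $p(e)=b_0$. Simplicial maps $\varphi,\psi\colon K\to L$ are contiguous, $\varphi\sim_c\psi$, if $\varphi(\sigma)\cup\psi(\sigma)$ is a simplex of $L$ for every simplex $\sigma$ of $K$; they are in the same contiguity class, $\varphi\sim\psi$, if they are joined by a finite sequence of simplicial maps with consecutive ones contiguous. Two complexes $K,L$ have the same strong homotopy type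 if there are simplicial maps $\varphi\colon K\to L$ and $\psi\colon L\to K$ with $\psi\circ\varphi\sim 1_K$ and $\varphi\circ\psi\sim1_L$. *)

theory Defs
  imports Main
begin

text \<open>A simplicial complex, finite or not, is given by the set of its simplices, which are
  nonempty finite sets of vertices.\<close>

definition abstract_complex :: "'a set set \<Rightarrow> bool" where
  "abstract_complex K \<longleftrightarrow>
     (\<forall>\<sigma>\<in>K. finite \<sigma> \<and> \<sigma> \<noteq> {}) \<and>
     (\<forall>\<sigma>\<in>K. \<forall>\<tau>. \<tau> \<noteq> {} \<and> \<tau> \<subseteq> \<sigma> \<longrightarrow> \<tau> \<in> K)"

definition vertices :: "'a set set \<Rightarrow> 'a set" where
  "vertices K = \<Union>K"

text \<open>Simplicial maps are represented by total functions on the ambient types; only their values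
  on vertices matter.\<close>

definition simplicial_map :: "'a set set \<Rightarrow> 'b set set \<Rightarrow> ('a \<Rightarrow> 'b) \<Rightarrow> bool" where
  "simplicial_map K L f \<longleftrightarrow> (\<forall>\<sigma>\<in>K. f ` \<sigma> \<in> L)"

definition prod_complex :: "'a set set \<Rightarrow> 'b set set \<Rightarrow> ('a \<times> 'b) set set" where
  "prod_complex K L =
     {\<sigma>. finite \<sigma> \<and> \<sigma> \<subseteq> vertices K \<times> vertices L \<and> fst ` \<sigma> \<in> K \<and> snd ` \<sigma> \<in> L}"

definition interval_complex :: "nat \<Rightarrow> nat set set" where
  "interval_complex m = {{j} | j. j \<le> m} \<union> {{j, j + 1} | j. j < m}"

definition full_subcomplex :: "'a set set \<Rightarrow> 'a set \<Rightarrow> 'a set set" where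
  "full_subcomplex K W = {\<sigma> \<in> K. \<sigma> \<subseteq> W}"

text \<open>Homotopy lifting for all complexes \<open>K\<close> whose vertices are drawn from the type \<open>'k\<close>.\<close>

definition homotopy_lifting ::
    "'k itself \<Rightarrow> 'e set set \<Rightarrow> 'b set set \<Rightarrow> ('e \<Rightarrow> 'b) \<Rightarrow> bool" where
  "homotopy_lifting (T :: 'k itself) E B p \<longleftrightarrow>
     (\<forall>(K :: 'k set set) m H \<phi>.
        abstract_complex K \<and> m \<ge> 1 \<and>
        simplicial_map (prod_complex K (interval_complex m)) B H \<and>
        simplicial_map (prod_complex K {{0::nat}}) E \<phi> \<and>
        (\<forall>v\<in>vertices K. p (\<phi> (v, 0)) = H (v, 0)) \<longrightarrow>
        (\<exists>H'. simplicial_map (prod_complex K (interval_complex m)) E H' \<and>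
              (\<forall>v\<in>vertices K. H' (v, 0) = \<phi> (v, 0)) \<and>
              (\<forall>x\<in>vertices (prod_complex K (interval_complex m)). p (H' x) = H x)))"

text \<open>A definition in HOL cannot quantify over the vertex type of \<open>K\<close>. Requiring lifting
  for complexes with vertices in \<open>'e \<times> (nat \<Rightarrow> 'b)\<close> loses nothing: by
  \<open>homotopy_lifting_all_types\<close> below, it implies lifting for complexes on every type
  \<open>'k\<close>. The reason is that every lifting problem \<open>(K, H, \<phi>)\<close> is pulled back along
  \<open>v \<mapsto> (\<phi> (v, 0), H (v, _))\<close> from a universal one, whose vertices are the pairs of a
  vertex \<open>e\<close> of \<open>E\<close> and an edge path in \<open>B\<close> starting at \<open>p e\<close>.\<close>

definition simplicial_fibration :: "'e set set \<Rightarrow> 'b set set \<Rightarrow> ('e \<Rightarrow> 'b) \<Rightarrow> bool" where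
  "simplicial_fibration E B p \<longleftrightarrow>
     simplicial_map E B p \<and> homotopy_lifting TYPE('e \<times> (nat \<Rightarrow> 'b)) E B p"

definition connected_complex :: "'b set set \<Rightarrow> bool" where
  "connected_complex B \<longleftrightarrow>
     (\<forall>b\<in>vertices B. \<forall>b'\<in>vertices B.
        \<exists>n \<gamma>. n \<ge> 1 \<and> simplicial_map (interval_complex n) B \<gamma> \<and> \<gamma> 0 = b \<and> \<gamma> n = b')"

definition simplicial_fiber :: "'e set set \<Rightarrow> ('e \<Rightarrow> 'b) \<Rightarrow> 'b \<Rightarrow> 'e set set" where
  "simplicial_fiber E p b = full_subcomplex E {e \<in> vertices E. p e = b}"

definition contiguous :: "'a set set \<Rightarrow> 'b set set \<Rightarrow> ('a \<Rightarrow> 'b) \<Rightarrow> ('a \<Rightarrow> 'b) \<Rightarrow> bool" where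
  "contiguous K L \<phi> \<psi> \<longleftrightarrow>
     simplicial_map K L \<phi> \<and> simplicial_map K L \<psi> \<and> (\<forall>\<sigma>\<in>K. \<phi> ` \<sigma> \<union> \<psi> ` \<sigma> \<in> L)"

definition same_contiguity_class ::
    "'a set set \<Rightarrow> 'b set set \<Rightarrow> ('a \<Rightarrow> 'b) \<Rightarrow> ('a \<Rightarrow> 'b) \<Rightarrow> bool" where
  "same_contiguity_class K L \<phi> \<psi> \<longleftrightarrow>
     simplicial_map K L \<phi> \<and> simplicial_map K L \<psi> \<and> (contiguous K L)\<^sup>*\<^sup>* \<phi> \<psi>"

definition same_strong_homotopy_type :: "'a set set \<Rightarrow> 'b set set \<Rightarrow> bool" where
  "same_strong_homotopy_type K L \<longleftrightarrow>
     (\<exists>\<phi> \<psi>. simplicial_map K L \<phi> \<and> simplicial_map L K \<psi> \<and>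
        same_contiguity_class K K (\<psi> \<circ> \<phi>) id \<and>
        same_contiguity_class L L (\<phi> \<circ> \<psi>) id)"

lemma simplex_finite: "abstract_complex K \<Longrightarrow> \<sigma> \<in> K \<Longrightarrow> finite \<sigma>"
  and simplex_nonempty: "abstract_complex K \<Longrightarrow> \<sigma> \<in> K \<Longrightarrow> \<sigma> \<noteq> {}"
  and simplex_face: "abstract_complex K \<Longrightarrow> \<sigma> \<in> K \<Longrightarrow> \<tau> \<subseteq> \<sigma> \<Longrightarrow> \<tau> \<noteq> {} \<Longrightarrow> \<tau> \<in> K"
  unfolding abstract_complex_def by blast+

lemma prod_complex_iff:
  assumes "abstract_complex K" "abstract_complex L"
  shows "\<sigma> \<in> prod_complex K L \<longleftrightarrow> fst ` \<sigma> \<in> K \<and> snd ` \<sigma> \<in> L"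
proof
  assume R: "fst ` \<sigma> \<in> K \<and> snd ` \<sigma> \<in> L"
  have sub: "\<sigma> \<subseteq> fst ` \<sigma> \<times> snd ` \<sigma>"
    by force
  have "finite (fst ` \<sigma> \<times> snd ` \<sigma>)"
    using R assms by (simp add: abstract_complex_def)
  then have "finite \<sigma>"
    using sub finite_subset by blast
  moreover have "\<sigma> \<subseteq> vertices K \<times> vertices L"
    using sub R unfolding vertices_def by blast
  ultimately show "\<sigma> \<in> prod_complex K L"
    using R unfolding prod_complex_def by blast
qed (auto simp: prod_complex_def)

lemma vertices_prod_complex:
  assumes "abstract_complex K" "abstract_complex L"
  shows "vertices (prod_complex K L) = vertices K \<times> vertices L"
proof
  show "vertices K \<times> vertices L \<subseteq> vertices (prod_complex K L)"
  proof clarify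
    fix a b assume "a \<in> vertices K" "b \<in> vertices L"
    then obtain \<sigma> \<tau> where "a \<in> \<sigma>" "\<sigma> \<in> K" "b \<in> \<tau>" "\<tau> \<in> L"
      unfolding vertices_def by blast
    then have "{a} \<in> K" "{b} \<in> L"
      using simplex_face[OF assms(1), of \<sigma> "{a}"] simplex_face[OF assms(2), of \<tau> "{b}"]
      by simp_all
    then have "{(a, b)} \<in> prod_complex K L"
      by (simp add: prod_complex_iff[OF assms])
    then show "(a, b) \<in> vertices (prod_complex K L)"
      unfolding vertices_def by blast
  qed
  show "vertices (prod_complex K L) \<subseteq> vertices K \<times> vertices L"
  proof
    fix z assume "z \<in> vertices (prod_complex K L)"
    then obtain \<sigma> where "\<sigma> \<in> prod_complex K L" "z \<in> \<sigma>"
      unfolding vertices_def by (rule UnionE)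
    then show "z \<in> vertices K \<times> vertices L"
      by (simp add: prod_complex_def subset_eq)
  qed
qed

lemma abstract_complex_interval: "abstract_complex (interval_complex m)"
  unfolding abstract_complex_def
proof (intro conjI ballI allI impI)
  fix \<sigma> \<tau> assume \<sigma>: "\<sigma> \<in> interval_complex m" and \<tau>: "\<tau> \<noteq> {} \<and> \<tau> \<subseteq> \<sigma>"
  from \<sigma> consider (v) j where "\<sigma> = {j}" "j \<le> m" | (e) j where "\<sigma> = {j, j + 1}" "j < m"
    unfolding interval_complex_def by blast
  then show "\<tau> \<in> interval_complex m"
  proof cases
    case v
    then have "\<tau> = {j}" using \<tau> by blast
    then show ?thesis using v unfolding interval_complex_def by blast
  next
    case e
    then consider "\<tau> = {j}" | "\<tau> = {j + 1}" | "\<tau> = {j, j + 1}" using \<tau> by blast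
    moreover have "j \<le> m" "j + 1 \<le> m" using e by simp_all
    ultimately show ?thesis using e unfolding interval_complex_def by cases blast+
  qed
qed (auto simp: interval_complex_def)

lemma abstract_complex_point: "abstract_complex {{a}}"
  unfolding abstract_complex_def by auto

lemma homotopy_lifting_all_types:
  fixes E :: "'e set set" and B :: "'b set set" and p :: "'e \<Rightarrow> 'b"
  assumes E: "abstract_complex E" and B: "abstract_complex B"
    and univ: "homotopy_lifting TYPE('e \<times> (nat \<Rightarrow> 'b)) E B p"
  shows "homotopy_lifting TYPE('k) E B p"
  unfolding homotopy_lifting_def
proof (intro allI impI, elim conjE)
  fix K :: "'k set set" and m :: nat and H :: "'k \<times> nat \<Rightarrow> 'b" and \<phi> :: "'k \<times> nat \<Rightarrow> 'e"
  let ?I = "interval_complex m"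
  assume K: "abstract_complex K" and m: "m \<ge> 1"
    and H: "simplicial_map (prod_complex K ?I) B H"
    and \<phi>: "simplicial_map (prod_complex K {{0}}) E \<phi>"
    and start: "\<forall>v\<in>vertices K. p (\<phi> (v, 0)) = H (v, 0)"
  note I = abstract_complex_interval[of m]
  note P = abstract_complex_point[of "0::nat"]
  define U :: "('e \<times> (nat \<Rightarrow> 'b)) set set" where
    "U = {S. fst ` S \<in> E \<and> finite S \<and> (\<forall>x\<in>S. snd x 0 = p (fst x)) \<and>
             (\<forall>\<tau>\<in>?I. (\<lambda>(x, j). snd x j) ` (S \<times> \<tau>) \<in> B)}"
  define u where "u v = (\<phi> (v, 0::nat), \<lambda>j. H (v, j))" for v
  have cU: "abstract_complex U"
    unfolding abstract_complex_def
  proof (intro conjI ballI allI impI)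
    fix S assume S: "S \<in> U"
    then show "finite S" unfolding U_def by blast
    show "S \<noteq> {}" using S E unfolding U_def abstract_complex_def by auto
  next
    fix S T assume S: "S \<in> U" and T: "T \<noteq> {} \<and> T \<subseteq> S"
    have "fst ` T \<in> E"
    proof (rule simplex_face[OF E])
      show "fst ` S \<in> E" using S unfolding U_def by blast
    qed (use T in auto)
    moreover have "finite T" "\<forall>x\<in>T. snd x 0 = p (fst x)"
      using S T unfolding U_def by (auto intro: finite_subset)
    moreover have "(\<lambda>(x, j). snd x j) ` (T \<times> \<tau>) \<in> B" if "\<tau> \<in> ?I" for \<tau>
    proof -
      have "(\<lambda>(x, j). snd x j) ` (S \<times> \<tau>) \<in> B"
        using S that unfolding U_def by blast
      moreover have "(\<lambda>(x, j). snd x j) ` (T \<times> \<tau>) \<subseteq> (\<lambda>(x, j). snd x j) ` (S \<times> \<tau>)"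
        using T by blast
      moreover have "(\<lambda>(x, j). snd x j) ` (T \<times> \<tau>) \<noteq> {}"
        using T simplex_nonempty[OF I that] by simp
      ultimately show ?thesis
        using simplex_face[OF B] by blast
    qed
    ultimately show "T \<in> U" unfolding U_def by blast
  qed
  have HU: "simplicial_map (prod_complex U ?I) B (\<lambda>(x, j). snd x j)"
    unfolding simplicial_map_def
  proof
    fix T assume "T \<in> prod_complex U ?I"
    then have T: "fst ` T \<in> U" "snd ` T \<in> ?I"
      by (auto simp: prod_complex_iff[OF cU I])
    have "(\<lambda>(x, j). snd x j) ` (fst ` T \<times> snd ` T) \<in> B"
      using T unfolding U_def by blast
    moreover have "(\<lambda>(x, j). snd x j) ` T \<subseteq> (\<lambda>(x, j). snd x j) ` (fst ` T \<times> snd ` T)"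
      by (intro image_mono) force
    moreover have "(\<lambda>(x, j). snd x j) ` T \<noteq> {}"
      using simplex_nonempty[OF I T(2)] by simp
    ultimately show "(\<lambda>(x, j). snd x j) ` T \<in> B"
      using simplex_face[OF B] by blast
  qed
  have \<phi>U: "simplicial_map (prod_complex U {{0}}) E (\<lambda>(x, j::nat). fst x)"
    unfolding simplicial_map_def
  proof
    fix T assume "T \<in> prod_complex U {{0::nat}}"
    then have "fst ` T \<in> U"
      unfolding prod_complex_def by blast
    then have "fst ` (fst ` T) \<in> E"
      unfolding U_def by blast
    then show "(\<lambda>(x, j::nat). fst x) ` T \<in> E"
      by (simp add: image_image case_prod_unfold)
  qed
  have startU: "\<forall>x\<in>vertices U. p ((\<lambda>(x, j::nat). fst x) (x, 0)) = (\<lambda>(x, j). snd x j) (x, 0)"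
    unfolding vertices_def U_def by auto
  obtain G where G: "simplicial_map (prod_complex U ?I) E G"
      "\<forall>x\<in>vertices U. G (x, 0) = fst x"
      "\<forall>z\<in>vertices (prod_complex U ?I). p (G z) = (\<lambda>(x, j). snd x j) z"
  proof -
    have "abstract_complex U \<and> m \<ge> 1 \<and>
        simplicial_map (prod_complex U ?I) B (\<lambda>(x, j). snd x j) \<and>
        simplicial_map (prod_complex U {{0}}) E (\<lambda>(x, j::nat). fst x) \<and>
        (\<forall>x\<in>vertices U. p ((\<lambda>(x, j::nat). fst x) (x, 0)) = (\<lambda>(x, j). snd x j) (x, 0))"
      using cU m HU \<phi>U startU by (intro conjI)
    from univ[unfolded homotopy_lifting_def, THEN spec, THEN spec, THEN spec, THEN spec,
        THEN mp, OF this]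
    show thesis using that by (elim exE conjE) simp
  qed
  have u: "u ` \<sigma> \<in> U" if \<sigma>: "\<sigma> \<in> K" for \<sigma>
  proof -
    have "\<sigma> \<noteq> {}" "finite \<sigma>"
      using simplex_nonempty[OF K \<sigma>] simplex_finite[OF K \<sigma>] by simp_all
    have "\<sigma> \<subseteq> vertices K"
      using \<sigma> unfolding vertices_def by blast
    have "\<sigma> \<times> {0} \<in> prod_complex K {{0::nat}}"
      using \<sigma> \<open>\<sigma> \<noteq> {}\<close> by (simp add: prod_complex_iff[OF K P])
    then have "\<phi> ` (\<sigma> \<times> {0}) \<in> E" using \<phi> unfolding simplicial_map_def by blast
    moreover have "\<phi> ` (\<sigma> \<times> {0}) = fst ` u ` \<sigma>"
      unfolding u_def by (auto simp: image_iff)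
    ultimately have "fst ` u ` \<sigma> \<in> E" by simp
    moreover have "\<forall>x\<in>u ` \<sigma>. snd x 0 = p (fst x)"
      using start \<open>\<sigma> \<subseteq> vertices K\<close> unfolding u_def by auto
    moreover have "(\<lambda>(x, j). snd x j) ` (u ` \<sigma> \<times> \<tau>) \<in> B" if \<tau>: "\<tau> \<in> ?I" for \<tau>
    proof -
      have "\<tau> \<noteq> {}" using simplex_nonempty[OF I \<tau>] .
      then have "\<sigma> \<times> \<tau> \<in> prod_complex K ?I"
        using \<sigma> \<tau> \<open>\<sigma> \<noteq> {}\<close> by (simp add: prod_complex_iff[OF K I])
      then have "H ` (\<sigma> \<times> \<tau>) \<in> B" using H unfolding simplicial_map_def by blast
      moreover have "(\<lambda>(x, j). snd x j) ` (u ` \<sigma> \<times> \<tau>) = H ` (\<sigma> \<times> \<tau>)"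
        unfolding u_def by force
      ultimately show ?thesis by simp
    qed
    ultimately show ?thesis using \<open>finite \<sigma>\<close> unfolding U_def by blast
  qed
  have uv: "u v \<in> vertices U" if "v \<in> vertices K" for v
    using that u unfolding vertices_def by blast
  define H' where "H' = (\<lambda>(v, j). G (u v, j))"
  have "simplicial_map (prod_complex K ?I) E H'"
    unfolding simplicial_map_def
  proof
    fix T assume "T \<in> prod_complex K ?I"
    then have T: "fst ` T \<in> K" "snd ` T \<in> ?I"
      by (auto simp: prod_complex_iff[OF K I])
    let ?T = "(\<lambda>(v, j). (u v, j)) ` T"
    have "fst ` ?T = u ` fst ` T" "snd ` ?T = snd ` T"
      by (simp_all add: image_image case_prod_unfold)
    then have "?T \<in> prod_complex U ?I"
      using T u by (simp add: prod_complex_iff[OF cU I])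
    then have "G ` ?T \<in> E" using G(1) unfolding simplicial_map_def by blast
    moreover have "H' ` T = G ` ?T"
      unfolding H'_def by (simp add: image_image case_prod_unfold)
    ultimately show "H' ` T \<in> E" by simp
  qed
  moreover have "\<forall>v\<in>vertices K. H' (v, 0) = \<phi> (v, 0)"
    using G(2) uv unfolding H'_def by (auto simp: u_def)
  moreover have "\<forall>x\<in>vertices (prod_complex K ?I). p (H' x) = H x"
    using G(3) uv unfolding H'_def vertices_prod_complex[OF K I] vertices_prod_complex[OF cU I]
    by (auto simp: u_def)
  ultimately show "\<exists>H'. simplicial_map (prod_complex K ?I) E H' \<and>
      (\<forall>v\<in>vertices K. H' (v, 0) = \<phi> (v, 0)) \<and>
      (\<forall>x\<in>vertices (prod_complex K ?I). p (H' x) = H x)"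
    by blast
qed

end

theory Submission
  imports Defs
begin

text \<open>A fibration lifts contiguities: if \<open>p \<circ> g\<close> is contiguous to \<open>h\<close>, then
  \<open>g\<close> is contiguous to some \<open>g'\<close> with \<open>p \<circ> g' = h\<close>. For an edge
  \<open>{b, b'}\<close>, lifting the constant map \<open>b'\<close> from the inclusion of the fiber over
  \<open>b\<close> gives a map of fibers that is contiguous, in \<open>E\<close>, to the inclusion. Going to
  \<open>b'\<close> and back yields \<open>F \<times> I\<^sub>2 \<rightarrow> E\<close> over the path \<open>b, b', b\<close>, which is
  contiguous to the constant path. Lifting this contiguity and following the three other sides of
  the resulting square, all of which lie over \<open>b\<close>, joins the identity to the round trip
  inside the fiber. A general edge path follows by transitivity.\<close>

section \<open>Contiguity classes and strong homotopy type\<close>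

text \<open>Both maps are automatically simplicial: each image is a nonempty face of the
  union.\<close>

lemma contiguousI:
  assumes "abstract_complex K" "abstract_complex L"
    and "\<And>\<sigma>. \<sigma> \<in> K \<Longrightarrow> f ` \<sigma> \<union> g ` \<sigma> \<in> L"
  shows "contiguous K L f g"
  unfolding contiguous_def simplicial_map_def
proof (intro conjI ballI)
  fix \<sigma> assume \<sigma>: "\<sigma> \<in> K"
  then have "\<sigma> \<noteq> {}"
    by (rule simplex_nonempty[OF assms(1)])
  then show "f ` \<sigma> \<in> L" "g ` \<sigma> \<in> L"
    using simplex_face[OF assms(2) assms(3)[OF \<sigma>]] by auto
qed (use assms(3) in blast)

lemma simplicial_map_comp:
  "simplicial_map K L f \<Longrightarrow> simplicial_map L M g \<Longrightarrow> simplicial_map K M (g \<circ> f)"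
  unfolding simplicial_map_def by (simp only: image_comp[symmetric]) blast

lemma contiguous_comp:
  assumes "simplicial_map K L a" "contiguous L M f g" "simplicial_map M N c"
  shows "contiguous K N (c \<circ> f \<circ> a) (c \<circ> g \<circ> a)"
  using assms unfolding contiguous_def simplicial_map_def
  by (simp only: image_comp[symmetric] image_Un[symmetric]) blast

lemma same_contiguity_class_comp:
  assumes a: "simplicial_map K L a" and fg: "same_contiguity_class L M f g"
    and c: "simplicial_map M N c"
  shows "same_contiguity_class K N (c \<circ> f \<circ> a) (c \<circ> g \<circ> a)"
proof -
  have "(contiguous L M)\<^sup>*\<^sup>* f g"
    using fg unfolding same_contiguity_class_def by blast
  then have "(contiguous K N)\<^sup>*\<^sup>* (c \<circ> f \<circ> a) (c \<circ> g \<circ> a)"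
  proof induction
    case (step y z)
    show ?case
      by (rule rtranclp_trans[OF step.IH r_into_rtranclp[of "contiguous K N", OF contiguous_comp[OF a step.hyps(2) c]]])
  qed (rule rtranclp.rtrancl_refl)
  then show ?thesis
    using a c fg unfolding same_contiguity_class_def by (simp add: simplicial_map_comp[of _ M] simplicial_map_comp[of _ L])
qed

lemma same_contiguity_class_trans:
  "same_contiguity_class K L f g \<Longrightarrow> same_contiguity_class K L g h \<Longrightarrow>
    same_contiguity_class K L f h"
  unfolding same_contiguity_class_def by auto

lemma same_strong_homotopy_type_refl: "same_strong_homotopy_type K K"
  unfolding same_strong_homotopy_type_def same_contiguity_class_def simplicial_map_def
  by (intro exI[of _ id]) simp

text \<open>In the composite round trip the inner one, \<open>k \<circ> h\<close> or
  \<open>f \<circ> g\<close>, is moved to \<open>id\<close> first; sandwiching preserves contiguity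
  classes, and the outer round trip remains.\<close>

lemma same_strong_homotopy_type_trans:
  assumes "same_strong_homotopy_type K L" "same_strong_homotopy_type L M"
  shows "same_strong_homotopy_type K M"
proof -
  obtain f g where f: "simplicial_map K L f" "simplicial_map L K g"
      "same_contiguity_class K K (g \<circ> f) id" "same_contiguity_class L L (f \<circ> g) id"
    using assms(1) unfolding same_strong_homotopy_type_def by blast
  obtain h k where h: "simplicial_map L M h" "simplicial_map M L k"
      "same_contiguity_class L L (k \<circ> h) id" "same_contiguity_class M M (h \<circ> k) id"
    using assms(2) unfolding same_strong_homotopy_type_def by blast
  have "simplicial_map K M (h \<circ> f)" "simplicial_map M K (g \<circ> k)"
    using simplicial_map_comp[OF f(1) h(1)] simplicial_map_comp[OF h(2) f(2)] by simp_all
  moreover have "same_contiguity_class K K ((g \<circ> k) \<circ> (h \<circ> f)) id"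
    using same_contiguity_class_trans[OF same_contiguity_class_comp[OF f(1) h(3) f(2)]] f(3)
    by (simp add: comp_assoc)
  moreover have "same_contiguity_class M M ((h \<circ> f) \<circ> (g \<circ> k)) id"
    using same_contiguity_class_trans[OF same_contiguity_class_comp[OF h(2) f(4) h(1)]] h(4)
    by (simp add: comp_assoc)
  ultimately show ?thesis
    unfolding same_strong_homotopy_type_def by blast
qed

section \<open>Products and fibers as complexes\<close>

text \<open>Needed because a product \<open>K \<times> I\<close> will itself serve as the domain of
  a second lifting problem.\<close>

lemma abstract_complex_prod:
  assumes "abstract_complex K" "abstract_complex L"
  shows "abstract_complex (prod_complex K L)"
  unfolding abstract_complex_def
proof (intro conjI ballI allI impI)
  fix \<sigma> assume \<sigma>: "\<sigma> \<in> prod_complex K L"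
  then show "finite \<sigma>"
    unfolding prod_complex_def by blast
  show "\<sigma> \<noteq> {}"
    using \<sigma> simplex_nonempty[OF assms(1)] by (force simp: prod_complex_iff[OF assms])
  fix \<tau> assume \<tau>: "\<tau> \<noteq> {} \<and> \<tau> \<subseteq> \<sigma>"
  have "fst ` \<sigma> \<in> K" "snd ` \<sigma> \<in> L"
    using \<sigma> by (simp_all add: prod_complex_iff[OF assms])
  then show "\<tau> \<in> prod_complex K L"
    using \<tau> simplex_face[OF assms(1), of "fst ` \<sigma>" "fst ` \<tau>"]
      simplex_face[OF assms(2), of "snd ` \<sigma>" "snd ` \<tau>"]
    by (simp add: prod_complex_iff[OF assms] image_mono)
qed

lemma Times_in_prod_complex:
  assumes "abstract_complex K" "abstract_complex L" "\<sigma> \<in> K" "\<tau> \<in> L"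
  shows "\<sigma> \<times> \<tau> \<in> prod_complex K L"
  using assms simplex_nonempty[OF assms(1,3)] simplex_nonempty[OF assms(2,4)]
  by (simp add: prod_complex_iff[OF assms(1,2)])

lemma abstract_complex_fiber:
  "abstract_complex E \<Longrightarrow> abstract_complex (simplicial_fiber E p b)"
  unfolding simplicial_fiber_def full_subcomplex_def abstract_complex_def by blast

lemma fiber_iff: "\<sigma> \<in> simplicial_fiber E p b \<longleftrightarrow> \<sigma> \<in> E \<and> (\<forall>e\<in>\<sigma>. p e = b)"
  unfolding simplicial_fiber_def full_subcomplex_def vertices_def by blast

section \<open>Lifting contiguities\<close>

text \<open>A contiguity is the same as a simplicial map on the product with the one-edge interval,
  so this is homotopy lifting for \<open>m = 1\<close>, read at the far end.\<close>

lemma contiguity_lifting: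
  fixes E :: "'e set set" and B :: "'b set set" and p :: "'e \<Rightarrow> 'b" and K :: "'k set set"
  assumes E: "abstract_complex E" and B: "abstract_complex B" and K: "abstract_complex K"
    and fib: "simplicial_fibration E B p"
    and g: "simplicial_map K E g" and gh: "contiguous K B (p \<circ> g) h"
  obtains g' where "contiguous K E g g'" "\<And>v. v \<in> vertices K \<Longrightarrow> p (g' v) = h v"
proof -
  let ?I = "interval_complex 1"
  note I = abstract_complex_interval[of 1]
  note P = abstract_complex_point[of "0::nat"]
  define H where "H = (\<lambda>(v, j::nat). if j = 0 then p (g v) else h v)"
  define \<phi> where "\<phi> = (\<lambda>(v, j::nat). g v)"
  have H: "simplicial_map (prod_complex K ?I) B H"
    unfolding simplicial_map_def
  proof
    fix T assume "T \<in> prod_complex K ?I"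
    then have T: "fst ` T \<in> K"
      unfolding prod_complex_def by blast
    then have "(p \<circ> g) ` fst ` T \<union> h ` fst ` T \<in> B"
      using gh unfolding contiguous_def by blast
    \<comment> \<open>Whatever levels \<open>T\<close> meets, its image lies in the simplex supplied
      by contiguity over the projection of \<open>T\<close>.\<close>
    moreover have "H ` T \<subseteq> (p \<circ> g) ` fst ` T \<union> h ` fst ` T"
      unfolding H_def by force
    moreover have "H ` T \<noteq> {}"
      using simplex_nonempty[OF K T] by simp
    ultimately show "H ` T \<in> B"
      by (rule simplex_face[OF B])
  qed
  have \<phi>: "simplicial_map (prod_complex K {{0}}) E \<phi>"
    using g unfolding simplicial_map_def \<phi>_def
    by (auto simp: prod_complex_iff[OF K P] image_image case_prod_unfold
        dest!: bspec[of K "\<lambda>\<sigma>. g ` \<sigma> \<in> E"])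
  \<comment> \<open>The passage to an arbitrary vertex type matters: the lemma is applied both to
    fibers and to products of a complex with an interval.\<close>
  have "homotopy_lifting TYPE('k) E B p"
    using homotopy_lifting_all_types[OF E B] fib unfolding simplicial_fibration_def by blast
  moreover have "\<forall>v\<in>vertices K. p (\<phi> (v, 0)) = H (v, 0)"
    unfolding H_def \<phi>_def by simp
  ultimately obtain H' where H': "simplicial_map (prod_complex K ?I) E H'"
      "\<And>v. v \<in> vertices K \<Longrightarrow> H' (v, 0) = \<phi> (v, 0)"
      "\<And>x. x \<in> vertices (prod_complex K ?I) \<Longrightarrow> p (H' x) = H x"
    using K H \<phi> unfolding homotopy_lifting_def by (metis order_refl)
  show thesis
  proof
    show "contiguous K E g (\<lambda>v. H' (v, 1))"
    proof (rule contiguousI[OF K E])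
      fix \<sigma> assume \<sigma>: "\<sigma> \<in> K"
      \<comment> \<open>The lift sends the prism \<open>\<sigma> \<times> {0, 1}\<close> to one
        simplex, which is the union of the images of its two ends.\<close>
      have "{0, 1} \<in> ?I"
        unfolding interval_complex_def by auto
      then have "H' ` (\<sigma> \<times> {0, 1}) \<in> E"
        using Times_in_prod_complex[OF K I \<sigma>] H'(1) unfolding simplicial_map_def by blast
      moreover have "H' ` (\<sigma> \<times> {0, 1}) = (\<lambda>v. H' (v, 0)) ` \<sigma> \<union> (\<lambda>v. H' (v, 1)) ` \<sigma>"
        by auto
      moreover have "(\<lambda>v. H' (v, 0)) ` \<sigma> = g ` \<sigma>"
        using \<sigma> H'(2) unfolding \<phi>_def vertices_def by (intro image_cong) auto
      ultimately show "g ` \<sigma> \<union> (\<lambda>v. H' (v, 1)) ` \<sigma> \<in> E"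
        by simp
    qed
    fix v assume "v \<in> vertices K"
    moreover have "1 \<in> vertices ?I"
      unfolding vertices_def interval_complex_def by auto
    ultimately show "p (H' (v, 1)) = h v"
      using H'(3)[of "(v, 1)"] unfolding H_def vertices_prod_complex[OF K I] by simp
  qed
qed

section \<open>Transport between fibers over an edge\<close>

text \<open>Here \<open>id\<close> stands for the inclusion of the fiber; the contiguity lives in
  \<open>E\<close>, since the two maps land over \<open>b\<close> and \<open>b'\<close>
  respectively.\<close>

lemma fiber_transport:
  assumes E: "abstract_complex E" and B: "abstract_complex B"
    and fib: "simplicial_fibration E B p" and e: "{b, b'} \<in> B"
  obtains g where "simplicial_map (simplicial_fiber E p b) (simplicial_fiber E p b') g"
    "contiguous (simplicial_fiber E p b) E id g"
proof -
  let ?F = "simplicial_fiber E p b"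
  note F = abstract_complex_fiber[OF E, of p b]
  have "contiguous ?F B (p \<circ> id) (\<lambda>_. b')"
  proof (rule contiguousI[OF F B])
    fix \<sigma> assume \<sigma>: "\<sigma> \<in> ?F"
    then have "\<sigma> \<noteq> {}" "\<forall>x\<in>\<sigma>. p x = b"
      using simplex_nonempty[OF F] by (auto simp: fiber_iff)
    then have "(p \<circ> id) ` \<sigma> \<union> (\<lambda>_. b') ` \<sigma> = {b, b'}"
      by auto
    then show "(p \<circ> id) ` \<sigma> \<union> (\<lambda>_. b') ` \<sigma> \<in> B"
      using e by simp
  qed
  moreover have "simplicial_map ?F E id"
    unfolding simplicial_map_def by (simp add: fiber_iff)
  ultimately obtain g where g: "contiguous ?F E id g" "\<And>v. v \<in> vertices ?F \<Longrightarrow> p (g v) = b'"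
    using contiguity_lifting[OF E B F fib] by blast
  have "simplicial_map ?F (simplicial_fiber E p b') g"
    using g unfolding simplicial_map_def contiguous_def vertices_def by (auto simp: fiber_iff)
  then show thesis
    using g(1) that by blast
qed

text \<open>The detour through \<open>g\<close> leaves the fiber over \<open>b\<close>. The lift
  \<open>G'\<close> of the contracted path supplies rows \<open>k 0\<close>, \<open>k 1\<close>,
  \<open>k 2\<close> over \<open>b\<close>, and the detour is replaced by the chain
  \<open>f\<close>, \<open>k 0\<close>, \<open>k 1\<close>, \<open>k 2\<close>,
  \<open>h\<close>.\<close>

lemma round_trip_in_fiber:
  assumes E: "abstract_complex E" and B: "abstract_complex B" and K: "abstract_complex K"
    and fib: "simplicial_fibration E B p" and e: "{b, b'} \<in> B"
    and f: "simplicial_map K (simplicial_fiber E p b) f"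
    and g: "simplicial_map K (simplicial_fiber E p b') g"
    and h: "simplicial_map K (simplicial_fiber E p b) h"
    and fg: "contiguous K E f g" and gh: "contiguous K E g h"
  shows "same_contiguity_class K (simplicial_fiber E p b) f h"
proof -
  let ?F = "simplicial_fiber E p b"
  let ?I = "interval_complex 2"
  let ?L = "prod_complex K ?I"
  note I = abstract_complex_interval[of 2]
  note F = abstract_complex_fiber[OF E, of p b]
  note L = abstract_complex_prod[OF K I]
  define G where "G = (\<lambda>(v, j::nat). if j = 0 then f v else if j = 1 then g v else h v)"
  have G: "simplicial_map ?L E G"
    unfolding simplicial_map_def
  proof
    fix T assume "T \<in> ?L"
    then have T: "fst ` T \<in> K" "snd ` T \<in> ?I"
      by (simp_all add: prod_complex_iff[OF K I])
    have fgT: "f ` fst ` T \<union> g ` fst ` T \<in> E" "g ` fst ` T \<union> h ` fst ` T \<in> E"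
      using fg gh T(1) unfolding contiguous_def by blast+
    have ne: "G ` T \<noteq> {}"
      using simplex_nonempty[OF K T(1)] by simp
    \<comment> \<open>No simplex of the interval contains both 0 and 2, so only one of the two given
      contiguities is involved at a time.\<close>
    have "snd ` T \<subseteq> {0, 1} \<or> snd ` T \<subseteq> {1, 2}"
    proof -
      consider j where "snd ` T = {j}" "j \<le> 2" | j where "snd ` T = {j, j + 1}" "j < 2"
        using T(2) unfolding interval_complex_def by blast
      then show ?thesis
      proof cases
        case 1
        have "j = 0 \<or> j = 1 \<or> j = 2"
          using 1(2) by arith
        then show ?thesis
          unfolding 1(1) by blast
      next
        case 2
        have "j = 0 \<or> j = 1"
          using 2(2) by arith
        then show ?thesis
          unfolding 2(1) by (elim disjE) simp_all
      qed
    qed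
    moreover have "G ` T \<subseteq> f ` fst ` T \<union> g ` fst ` T" if "snd ` T \<subseteq> {0, 1}"
    proof (rule image_subsetI)
      fix x assume "x \<in> T"
      moreover obtain v j where x: "x = (v, j)"
        by fastforce
      ultimately have "v \<in> fst ` T" "j \<in> {0, 1}"
        using that by force+
      then show "G x \<in> f ` fst ` T \<union> g ` fst ` T"
        unfolding G_def x by (cases "j = 0") simp_all
    qed
    moreover have "G ` T \<subseteq> g ` fst ` T \<union> h ` fst ` T" if "snd ` T \<subseteq> {1, 2}"
    proof (rule image_subsetI)
      fix x assume "x \<in> T"
      moreover obtain v j where x: "x = (v, j)"
        by fastforce
      ultimately have "v \<in> fst ` T" "j \<in> {1, 2}"
        using that by force+
      then show "G x \<in> g ` fst ` T \<union> h ` fst ` T"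
        unfolding G_def x by (cases "j = 1") simp_all
    qed
    ultimately show "G ` T \<in> E"
      using simplex_face[OF E fgT(1) _ ne] simplex_face[OF E fgT(2) _ ne] by blast
  qed
  \<comment> \<open>The path \<open>b, b', b\<close> stays in a single simplex together with
    \<open>b\<close>, so one contiguity contracts it to the constant path.\<close>
  have "contiguous ?L B (p \<circ> G) (\<lambda>_. b)"
  proof (rule contiguousI[OF L B])
    fix T assume T: "T \<in> ?L"
    then have "fst ` T \<in> K"
      by (simp add: prod_complex_iff[OF K I])
    then have "\<forall>v\<in>fst ` T. p (f v) = b \<and> p (g v) = b' \<and> p (h v) = b"
      using f g h unfolding simplicial_map_def by (auto simp: fiber_iff)
    then have "(p \<circ> G) ` T \<union> (\<lambda>_. b) ` T \<subseteq> {b, b'}"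
      unfolding G_def by fastforce
    then show "(p \<circ> G) ` T \<union> (\<lambda>_. b) ` T \<in> B"
      using simplex_face[OF B e] simplex_nonempty[OF L T] by blast
  qed
  with G obtain G' where G': "contiguous ?L E G G'" "\<And>x. x \<in> vertices ?L \<Longrightarrow> p (G' x) = b"
    by (rule contiguity_lifting[OF E B L fib]) blast
  define k where "k j v = G' (v, j)" for j v
  have k: "p (k j v) = b" if "\<sigma> \<in> K" "v \<in> \<sigma>" "j \<le> 2" for \<sigma> v j
  proof -
    have "j \<in> vertices ?I"
      using that(3) unfolding vertices_def interval_complex_def by auto
    moreover have "v \<in> vertices K"
      using that unfolding vertices_def by blast
    ultimately show ?thesis
      unfolding k_def by (intro G'(2)) (simp add: vertices_prod_complex[OF K I])
  qed
  have pf: "p (f v) = b" "p (h v) = b" if "\<sigma> \<in> K" "v \<in> \<sigma>" for \<sigma> v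
    using f h that unfolding simplicial_map_def by (auto simp: fiber_iff)
  \<comment> \<open>Vertical sides of the square, from the contiguity of \<open>G\<close> and
    \<open>G'\<close>. At \<open>j = 0\<close> and \<open>j = 2\<close> the row of \<open>G\<close>
    is \<open>f\<close> or \<open>h\<close>, so these sides lie over \<open>b\<close>.\<close>
  have vert: "(\<lambda>v. G (v, j)) ` \<sigma> \<union> k j ` \<sigma> \<in> E" if "\<sigma> \<in> K" "j \<le> 2" for \<sigma> j
  proof -
    have "{j} \<in> ?I"
      using that unfolding interval_complex_def by blast
    then have "G ` (\<sigma> \<times> {j}) \<union> G' ` (\<sigma> \<times> {j}) \<in> E"
      using Times_in_prod_complex[OF K I that(1)] G'(1) unfolding contiguous_def by blast
    moreover have "G ` (\<sigma> \<times> {j}) = (\<lambda>v. G (v, j)) ` \<sigma>" "G' ` (\<sigma> \<times> {j}) = k j ` \<sigma>"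
      unfolding k_def by auto
    ultimately show ?thesis
      by simp
  qed
  \<comment> \<open>The side opposite to \<open>f\<close>, \<open>g\<close>, \<open>h\<close>:
    \<open>G'\<close> lies entirely over \<open>b\<close>, so its consecutive rows are contiguous
    inside the fiber.\<close>
  have horiz: "contiguous K ?F (k j) (k (j + 1))" if "j < 2" for j
  proof (rule contiguousI[OF K F])
    fix \<sigma> assume \<sigma>: "\<sigma> \<in> K"
    have "{j, j + 1} \<in> ?I"
      using that unfolding interval_complex_def by blast
    then have "G' ` (\<sigma> \<times> {j, j + 1}) \<in> E"
      using Times_in_prod_complex[OF K I \<sigma>] G'(1)
      unfolding contiguous_def simplicial_map_def by blast
    moreover have "G' ` (\<sigma> \<times> {j, j + 1}) = k j ` \<sigma> \<union> k (j + 1) ` \<sigma>"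
      unfolding k_def by auto
    ultimately show "k j ` \<sigma> \<union> k (j + 1) ` \<sigma> \<in> ?F"
      using k[OF \<sigma>] that by (auto simp: fiber_iff)
  qed
  have "contiguous K ?F f (k 0)"
  proof (rule contiguousI[OF K F])
    fix \<sigma> assume \<sigma>: "\<sigma> \<in> K"
    then show "f ` \<sigma> \<union> k 0 ` \<sigma> \<in> ?F"
      using vert[OF \<sigma>, of 0] k[OF \<sigma>] pf(1)[OF \<sigma>] unfolding G_def by (auto simp: fiber_iff)
  qed
  moreover have "contiguous K ?F (k 2) h"
  proof (rule contiguousI[OF K F])
    fix \<sigma> assume \<sigma>: "\<sigma> \<in> K"
    then show "k 2 ` \<sigma> \<union> h ` \<sigma> \<in> ?F"
      using vert[OF \<sigma>, of 2] k[OF \<sigma>] pf(2)[OF \<sigma>] unfolding G_def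
      by (auto simp: fiber_iff Un_commute)
  qed
  moreover have "contiguous K ?F (k 0) (k 1)" "contiguous K ?F (k 1) (k 2)"
    using horiz[of 0] horiz[of 1] by (simp_all add: numeral_2_eq_2)
  ultimately have "(contiguous K ?F)\<^sup>*\<^sup>* f h"
    by (meson converse_rtranclp_into_rtranclp rtranclp.rtrancl_refl)
  then show ?thesis
    using f h unfolding same_contiguity_class_def by blast
qed

lemma transport_round_trip:
  assumes E: "abstract_complex E" and B: "abstract_complex B"
    and fib: "simplicial_fibration E B p" and e: "{b, b'} \<in> B"
    and g: "simplicial_map (simplicial_fiber E p b) (simplicial_fiber E p b') g"
      "contiguous (simplicial_fiber E p b) E id g"
    and h: "simplicial_map (simplicial_fiber E p b') (simplicial_fiber E p b) h"
      "contiguous (simplicial_fiber E p b') E id h"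
  shows "same_contiguity_class (simplicial_fiber E p b) (simplicial_fiber E p b) (h \<circ> g) id"
proof -
  let ?F = "simplicial_fiber E p b"
  \<comment> \<open>Precompose the contiguity between the inclusion and \<open>h\<close> with
    \<open>g\<close>. Reversed, it gives the detour \<open>h \<circ> g\<close>, \<open>g\<close>,
    \<open>id\<close>, which ends at \<open>id\<close> as required.\<close>
  have "contiguous ?F E g (h \<circ> g)"
    using contiguous_comp[OF g(1) h(2), of E id] by (simp add: simplicial_map_def)
  then have "contiguous ?F E (h \<circ> g) g" "contiguous ?F E g id"
    using g(2) unfolding contiguous_def by (simp_all add: Un_commute)
  moreover have "simplicial_map ?F ?F (h \<circ> g)" "simplicial_map ?F ?F id"
    using simplicial_map_comp[OF g(1) h(1)] by (simp_all add: simplicial_map_def)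
  ultimately show ?thesis
    by (intro round_trip_in_fiber[OF E B abstract_complex_fiber[OF E] fib e _ g(1)])
qed

text \<open>The situation is symmetric in \<open>b\<close> and \<open>b'\<close>, so one round-trip
  lemma yields both homotopy identities.\<close>

lemma adjacent_fibers:
  assumes E: "abstract_complex E" and B: "abstract_complex B"
    and fib: "simplicial_fibration E B p" and e: "{b, b'} \<in> B"
  shows "same_strong_homotopy_type (simplicial_fiber E p b) (simplicial_fiber E p b')"
proof -
  have e': "{b', b} \<in> B"
    using e by (simp add: insert_commute)
  obtain g where g: "simplicial_map (simplicial_fiber E p b) (simplicial_fiber E p b') g"
      "contiguous (simplicial_fiber E p b) E id g"
    using fiber_transport[OF E B fib e] .
  obtain h where h: "simplicial_map (simplicial_fiber E p b') (simplicial_fiber E p b) h"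
      "contiguous (simplicial_fiber E p b') E id h"
    using fiber_transport[OF E B fib e'] .
  show ?thesis
    using g(1) h(1) transport_round_trip[OF E B fib e g h] transport_round_trip[OF E B fib e' h g]
    unfolding same_strong_homotopy_type_def by blast
qed

section \<open>Induction along an edge path in the base\<close>

theorem theorem6p3:
  fixes E :: "'e set set" and B :: "'b set set" and p :: "'e \<Rightarrow> 'b"
  assumes "abstract_complex E" and "abstract_complex B"
    and "simplicial_fibration E B p"
    and "connected_complex B"
    and "b \<in> vertices B" and "b' \<in> vertices B"
  shows "same_strong_homotopy_type (simplicial_fiber E p b) (simplicial_fiber E p b')"
proof -
  obtain n \<gamma> where \<gamma>: "simplicial_map (interval_complex n) B \<gamma>" "\<gamma> 0 = b" "\<gamma> n = b'"
    using assms(4-6) unfolding connected_complex_def by blast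
  have "same_strong_homotopy_type (simplicial_fiber E p b) (simplicial_fiber E p (\<gamma> j))"
    if "j \<le> n" for j
    using that
  proof (induction j)
    case 0
    then show ?case
      using \<gamma>(2) same_strong_homotopy_type_refl by simp
  next
    case (Suc j)
    then have "{j, Suc j} \<in> interval_complex n"
      unfolding interval_complex_def by auto
    then have "\<gamma> ` {j, Suc j} \<in> B"
      using \<gamma>(1) unfolding simplicial_map_def by blast
    \<comment> \<open>The path may pause, making this a single vertex;
      \<open>adjacent_fibers\<close> does not require distinct endpoints.\<close>
    then have "{\<gamma> j, \<gamma> (Suc j)} \<in> B"
      by simp
    then show ?case
      using same_strong_homotopy_type_trans adjacent_fibers[OF assms(1-3)] Suc by force
  qed
  then show ?thesis
    using \<gamma>(3) by blast
qed

end
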